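(* Let $\mathbb{K}$ be a field of characteristic not $2$, let $(\mathfrak{a},\{-,-\})$ be an affinely nilpotent Lie affgebra over $\mathbb{K}$ of index $n$, and let $o$ be any element of $\mathfrak{a}$. Then the tangent Lie algebra $(T_o\mathfrak{a},[-,-])$ is a nilpotent Lie algebra of the same index $n$.
   Context: A heap is a set $H$ with a ternary operation $\langle-,-,-\rangle$ satisfying $\langle v,w,\langle x,y,z\rangle\rangle=\langle\langle v,w,x\rangle,y,z\rangle$ and $\langle x,x,y\rangle=y=\langle y,x,x\rangle$; it is abelian if $\langle x,y,z\rangle=\langle z,y,x\rangle$. An affine space over $\mathbb{K}$ is a non-empty abelian heap $H$ with a map $\mathbb{K}\times H\times H\to H$, $(\alpha,x,y)\mapsto\alpha\triangleright_x y$, such that $\alpha\triangleright_x-$ and $-\triangleright_x y$ are heap morphisms ($\mathbb{K}$ being a heap by $\alpha-\beta+\gamma$), $(\alpha\beta)\triangleright_x y=\alpha\triangleright_x(\beta\triangleright_x y)$, $\alpha\triangleright_x y=\langle\alpha\triangleright_z y,\alpha\triangleright_z x,x\rangle$, $0\triangleright_x y=x$, $1\triangleright_x y=y$ (this is equivalent to the usual notion of affine space, with $\langle a,b,c\rangle=a-b+c$ and $\alpha\triangleright_a b=(1-\alpha)a+\alpha b$). Affine maps are heap morphisms $f$ with $f(\alpha\triangleright_x y)=\alpha\triangleright_{f(x)}f(y)$; an affine subspace is a non-empty subset closed under both operations. A Lie affgebra is an affine space $\mathfrak{a}$ with a binary operation $\{-,-\}$, affine in each argument, such that $\langle\{a,b\},\{a,a\},\{b,a\}\rangle=\{b,b\}$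 and $\langle\{a,\{b,c\}\},\{a,\{a,a\}\},\{b,\{c,a\}\},\{b,\{b,b\}\},\{c,\{a,b\}\}\rangle=\{c,\{c,c\}\}$ for all $a,b,c$, where $\langle x_1,\dots,x_5\rangle=\langle\langle x_1,x_2,x_3\rangle,x_4,x_5\rangle$. For $o\in\mathfrak{a}$, $T_o\mathfrak{a}$ is the vector space with underlying set $\mathfrak{a}$, addition $a+b=\langle a,o,b\rangle$, scalar multiplication $\alpha\cdot a=\alpha\triangleright_o a$ and zero $o$; it is a Lie algebra (the tangent Lie algebra) with bracket $[a,b]=\{a,b\}-\{a,o\}+\{o,o\}-\{o,b\}$. Set $E:=\{x\in\mathfrak{a}\mid\{x,a\}=\{a,x\}=x\ \text{for all } a\in\mathfrak{a}\}$ (either empty or a singleton). For affine subspaces $\mathfrak{b},\mathfrak{c}$ of $\mathfrak{a}$, $\{\mathfrak{b},\mathfrak{c}\}$ is the smallest affine subspace containing all $\{x,y\}$ with $x\in\mathfrak{b}$, $y\in\mathfrak{c}$. Put $\mathfrak{a}^{(0)}=\mathfrak{a}$, $\mathfrak{a}^{(m)}=\{\mathfrak{a},\mathfrak{a}^{(m-1)}\}$. Then $\mathfrak{a}$ is affinely nilpotent of index $n$ ($n$ a positive integer) if $\mathfrak{a}^{(n+k)}=\mathfrak{a}^{(n)}=E$ for all $k\in\mathbb{N}$. Likewise, for a Lie algebra $L$ put $L^{(0)}=L$, $L^{(m)}=[L,L^{(m-1)}]$; $T_o\mathfrak{a}$ is nilpotent of index $n$ if $(T_o\mathfrak{a})^{(n)}=(T_o\mathfrak{a})^{(n+k)}=\{o\}$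 for all $k\ge1$. (In both definitions $n$ is not required to be minimal.) *)

theory Defs
  imports "HOL-Algebra.Module"
begin

section \<open>Heaps\<close>

record 'a heap = "'a partial_object" +
  tern :: "'a \<Rightarrow> 'a \<Rightarrow> 'a \<Rightarrow> 'a"  (\<open>\<langle>_, _, _\<rangle>\<index>\<close>)

locale heap =
  fixes H (structure)
  assumes tern_closed:
      "\<lbrakk>x \<in> carrier H; y \<in> carrier H; z \<in> carrier H\<rbrakk> \<Longrightarrow> \<langle>x, y, z\<rangle> \<in> carrier H"
    and tern_assoc:
      "\<lbrakk>v \<in> carrier H; w \<in> carrier H; x \<in> carrier H; y \<in> carrier H; z \<in> carrier H\<rbrakk>
        \<Longrightarrow> \<langle>v, w, \<langle>x, y, z\<rangle>\<rangle> = \<langle>\<langle>v, w, x\<rangle>, y, z\<rangle>"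
    and tern_left: "\<lbrakk>x \<in> carrier H; y \<in> carrier H\<rbrakk> \<Longrightarrow> \<langle>x, x, y\<rangle> = y"
    and tern_right: "\<lbrakk>x \<in> carrier H; y \<in> carrier H\<rbrakk> \<Longrightarrow> \<langle>y, x, x\<rangle> = y"

locale abelian_heap = heap +
  assumes tern_commute:
      "\<lbrakk>x \<in> carrier H; y \<in> carrier H; z \<in> carrier H\<rbrakk> \<Longrightarrow> \<langle>x, y, z\<rangle> = \<langle>z, y, x\<rangle>"

definition heap_hom :: "('a, 'm) heap_scheme \<Rightarrow> ('b, 'n) heap_scheme \<Rightarrow> ('a \<Rightarrow> 'b) set"
  where "heap_hom H H' =
    {f \<in> carrier H \<rightarrow> carrier H'.
      \<forall>x\<in>carrier H. \<forall>y\<in>carrier H. \<forall>z\<in>carrier H. f \<langle>x, y, z\<rangle>\<^bsub>H\<^esub> = \<langle>f x, f y, f z\<rangle>\<^bsub>H'\<^esub>}"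

definition heap_of_ring :: "('k, 'm) ring_scheme \<Rightarrow> 'k heap"
  where "heap_of_ring K =
    \<lparr>carrier = carrier K, tern = (\<lambda>\<alpha> \<beta> \<gamma>. \<alpha> \<ominus>\<^bsub>K\<^esub> \<beta> \<oplus>\<^bsub>K\<^esub> \<gamma>)\<rparr>"

section \<open>Affine spaces\<close>

text \<open>\<open>act A \<alpha> x y\<close> stands for \<open>\<alpha> \<rhd>\<^sub>x y\<close>, i.e. \<open>(1 - \<alpha>) x + \<alpha> y\<close>.\<close>

record ('k, 'a) affine = "'a heap" +
  act :: "'k \<Rightarrow> 'a \<Rightarrow> 'a \<Rightarrow> 'a"

locale affine_space = K?: field K + abelian_heap A for K (structure) and A (structure) +
  assumes nonempty: "carrier A \<noteq> {}"
    and act_hom_point: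
      "\<lbrakk>\<alpha> \<in> carrier K; x \<in> carrier A\<rbrakk> \<Longrightarrow> act A \<alpha> x \<in> heap_hom A A"
    and act_hom_scalar:
      "\<lbrakk>x \<in> carrier A; y \<in> carrier A\<rbrakk>
        \<Longrightarrow> (\<lambda>\<alpha>. act A \<alpha> x y) \<in> heap_hom (heap_of_ring K) A"
    and act_mult:
      "\<lbrakk>\<alpha> \<in> carrier K; \<beta> \<in> carrier K; x \<in> carrier A; y \<in> carrier A\<rbrakk>
        \<Longrightarrow> act A (\<alpha> \<otimes>\<^bsub>K\<^esub> \<beta>) x y = act A \<alpha> x (act A \<beta> x y)"
    and act_base_change:
      "\<lbrakk>\<alpha> \<in> carrier K; x \<in> carrier A; y \<in> carrier A; z \<in> carrier A\<rbrakk>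
        \<Longrightarrow> act A \<alpha> x y = \<langle>act A \<alpha> z y, act A \<alpha> z x, x\<rangle>\<^bsub>A\<^esub>"
    and act_zero: "\<lbrakk>x \<in> carrier A; y \<in> carrier A\<rbrakk> \<Longrightarrow> act A \<zero>\<^bsub>K\<^esub> x y = x"
    and act_one: "\<lbrakk>x \<in> carrier A; y \<in> carrier A\<rbrakk> \<Longrightarrow> act A \<one>\<^bsub>K\<^esub> x y = y"

definition affine_maps ::
    "('k, 'r) ring_scheme \<Rightarrow> ('k, 'a, 'm) affine_scheme \<Rightarrow> ('k, 'b, 'n) affine_scheme \<Rightarrow> ('a \<Rightarrow> 'b) set"
  where "affine_maps K A B =
    {f \<in> heap_hom A B. \<forall>\<alpha>\<in>carrier K. \<forall>x\<in>carrier A. \<forall>y\<in>carrier A.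
      f (act A \<alpha> x y) = act B \<alpha> (f x) (f y)}"

definition affine_subspace ::
    "('k, 'r) ring_scheme \<Rightarrow> ('k, 'a, 'm) affine_scheme \<Rightarrow> 'a set \<Rightarrow> bool"
  where "affine_subspace K A W \<longleftrightarrow>
    W \<noteq> {} \<and> W \<subseteq> carrier A \<and>
    (\<forall>x\<in>W. \<forall>y\<in>W. \<forall>z\<in>W. \<langle>x, y, z\<rangle>\<^bsub>A\<^esub> \<in> W) \<and>
    (\<forall>\<alpha>\<in>carrier K. \<forall>x\<in>W. \<forall>y\<in>W. act A \<alpha> x y \<in> W)"

section \<open>Lie affgebras\<close>

record ('k, 'a) affgebra = "('k, 'a) affine" +
  affbr :: "'a \<Rightarrow> 'a \<Rightarrow> 'a"  (\<open>\<lbrace>_, _\<rbrace>\<index>\<close>)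

locale lie_affgebra = affine_space K A for K (structure) and A (structure) +
  assumes affbr_affine_right: "a \<in> carrier A \<Longrightarrow> (\<lambda>b. \<lbrace>a, b\<rbrace>\<^bsub>A\<^esub>) \<in> affine_maps K A A"
    and affbr_affine_left: "b \<in> carrier A \<Longrightarrow> (\<lambda>a. \<lbrace>a, b\<rbrace>\<^bsub>A\<^esub>) \<in> affine_maps K A A"
    and affine_antisymmetry:
      "\<lbrakk>a \<in> carrier A; b \<in> carrier A\<rbrakk>
        \<Longrightarrow> \<langle>\<lbrace>a, b\<rbrace>\<^bsub>A\<^esub>, \<lbrace>a, a\<rbrace>\<^bsub>A\<^esub>, \<lbrace>b, a\<rbrace>\<^bsub>A\<^esub>\<rangle>\<^bsub>A\<^esub> = \<lbrace>b, b\<rbrace>\<^bsub>A\<^esub>"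
    and affine_Jacobi:
      "\<lbrakk>a \<in> carrier A; b \<in> carrier A; c \<in> carrier A\<rbrakk>
        \<Longrightarrow> \<langle>\<langle>\<lbrace>a, \<lbrace>b, c\<rbrace>\<^bsub>A\<^esub>\<rbrace>\<^bsub>A\<^esub>, \<lbrace>a, \<lbrace>a, a\<rbrace>\<^bsub>A\<^esub>\<rbrace>\<^bsub>A\<^esub>, \<lbrace>b, \<lbrace>c, a\<rbrace>\<^bsub>A\<^esub>\<rbrace>\<^bsub>A\<^esub>\<rangle>\<^bsub>A\<^esub>,
              \<lbrace>b, \<lbrace>b, b\<rbrace>\<^bsub>A\<^esub>\<rbrace>\<^bsub>A\<^esub>, \<lbrace>c, \<lbrace>a, b\<rbrace>\<^bsub>A\<^esub>\<rbrace>\<^bsub>A\<^esub>\<rangle>\<^bsub>A\<^esub>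
            = \<lbrace>c, \<lbrace>c, c\<rbrace>\<^bsub>A\<^esub>\<rbrace>\<^bsub>A\<^esub>"

definition absorbing_points :: "('k, 'a, 'm) affgebra_scheme \<Rightarrow> 'a set"
  where "absorbing_points A =
    {x \<in> carrier A. \<forall>a\<in>carrier A. \<lbrace>x, a\<rbrace>\<^bsub>A\<^esub> = x \<and> \<lbrace>a, x\<rbrace>\<^bsub>A\<^esub> = x}"

text \<open>The smallest affine subspace containing all \<open>\<lbrace>x, y\<rbrace>\<close>. Affine subspaces are non-empty, so the
  intersection is one only because \<open>B\<close> and \<open>C\<close> are non-empty wherever this is used.\<close>

definition affbr_set ::
    "('k, 'r) ring_scheme \<Rightarrow> ('k, 'a, 'm) affgebra_scheme \<Rightarrow> 'a set \<Rightarrow> 'a set \<Rightarrow> 'a set"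
  where "affbr_set K A B C =
    \<Inter>{W. affine_subspace K A W \<and> (\<forall>x\<in>B. \<forall>y\<in>C. \<lbrace>x, y\<rbrace>\<^bsub>A\<^esub> \<in> W)}"

primrec aff_series ::
    "('k, 'r) ring_scheme \<Rightarrow> ('k, 'a, 'm) affgebra_scheme \<Rightarrow> nat \<Rightarrow> 'a set"
  where
    "aff_series K A 0 = carrier A"
  | "aff_series K A (Suc m) = affbr_set K A (carrier A) (aff_series K A m)"

definition affinely_nilpotent ::
    "('k, 'r) ring_scheme \<Rightarrow> ('k, 'a, 'm) affgebra_scheme \<Rightarrow> nat \<Rightarrow> bool"
  where "affinely_nilpotent K A n \<longleftrightarrow>
    n > 0 \<and>
    (\<forall>k. aff_series K A (n + k) = aff_series K A n \<and> aff_series K A n = absorbing_points A)"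

section \<open>Lie algebras\<close>

text \<open>The Lie bracket is the \<open>mult\<close> component of the module record;
  the \<open>one\<close> component plays no role.\<close>

locale lie_algebra = K?: field K + module K L for K (structure) and L (structure) +
  assumes lie_closed: "\<lbrakk>x \<in> carrier L; y \<in> carrier L\<rbrakk> \<Longrightarrow> x \<otimes>\<^bsub>L\<^esub> y \<in> carrier L"
    and lie_add_left:
      "\<lbrakk>x \<in> carrier L; y \<in> carrier L; z \<in> carrier L\<rbrakk>
        \<Longrightarrow> (x \<oplus>\<^bsub>L\<^esub> y) \<otimes>\<^bsub>L\<^esub> z = (x \<otimes>\<^bsub>L\<^esub> z) \<oplus>\<^bsub>L\<^esub> (y \<otimes>\<^bsub>L\<^esub> z)"
    and lie_add_right:
      "\<lbrakk>x \<in> carrier L; y \<in> carrier L; z \<in> carrier L\<rbrakk>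
        \<Longrightarrow> x \<otimes>\<^bsub>L\<^esub> (y \<oplus>\<^bsub>L\<^esub> z) = (x \<otimes>\<^bsub>L\<^esub> y) \<oplus>\<^bsub>L\<^esub> (x \<otimes>\<^bsub>L\<^esub> z)"
    and lie_smult_left:
      "\<lbrakk>\<alpha> \<in> carrier K; x \<in> carrier L; y \<in> carrier L\<rbrakk>
        \<Longrightarrow> (\<alpha> \<odot>\<^bsub>L\<^esub> x) \<otimes>\<^bsub>L\<^esub> y = \<alpha> \<odot>\<^bsub>L\<^esub> (x \<otimes>\<^bsub>L\<^esub> y)"
    and lie_smult_right:
      "\<lbrakk>\<alpha> \<in> carrier K; x \<in> carrier L; y \<in> carrier L\<rbrakk>
        \<Longrightarrow> x \<otimes>\<^bsub>L\<^esub> (\<alpha> \<odot>\<^bsub>L\<^esub> y) = \<alpha> \<odot>\<^bsub>L\<^esub> (x \<otimes>\<^bsub>L\<^esub> y)"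
    and lie_alternating: "x \<in> carrier L \<Longrightarrow> x \<otimes>\<^bsub>L\<^esub> x = \<zero>\<^bsub>L\<^esub>"
    and lie_Jacobi:
      "\<lbrakk>x \<in> carrier L; y \<in> carrier L; z \<in> carrier L\<rbrakk>
        \<Longrightarrow> (x \<otimes>\<^bsub>L\<^esub> (y \<otimes>\<^bsub>L\<^esub> z)) \<oplus>\<^bsub>L\<^esub> (y \<otimes>\<^bsub>L\<^esub> (z \<otimes>\<^bsub>L\<^esub> x)) \<oplus>\<^bsub>L\<^esub> (z \<otimes>\<^bsub>L\<^esub> (x \<otimes>\<^bsub>L\<^esub> y)) = \<zero>\<^bsub>L\<^esub>"

definition lie_set ::
    "('k, 'r) ring_scheme \<Rightarrow> ('k, 'a, 'm) module_scheme \<Rightarrow> 'a set \<Rightarrow> 'a set \<Rightarrow> 'a set"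
  where "lie_set K L U V = \<Inter>{W. submodule W K L \<and> (\<forall>x\<in>U. \<forall>y\<in>V. x \<otimes>\<^bsub>L\<^esub> y \<in> W)}"

primrec lie_series ::
    "('k, 'r) ring_scheme \<Rightarrow> ('k, 'a, 'm) module_scheme \<Rightarrow> nat \<Rightarrow> 'a set"
  where
    "lie_series K L 0 = carrier L"
  | "lie_series K L (Suc m) = lie_set K L (carrier L) (lie_series K L m)"

definition lie_nilpotent ::
    "('k, 'r) ring_scheme \<Rightarrow> ('k, 'a, 'm) module_scheme \<Rightarrow> nat \<Rightarrow> bool"
  where "lie_nilpotent K L n \<longleftrightarrow>
    n > 0 \<and> lie_series K L n = {\<zero>\<^bsub>L\<^esub>} \<and> (\<forall>k\<ge>1. lie_series K L (n + k) = {\<zero>\<^bsub>L\<^esub>})"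

section \<open>The tangent Lie algebra\<close>

definition tangent_space :: "('k, 'a, 'm) affine_scheme \<Rightarrow> 'a \<Rightarrow> ('k, 'a) module"
  where "tangent_space A p =
    \<lparr>carrier = carrier A, mult = undefined, one = undefined, zero = p,
     add = (\<lambda>a b. \<langle>a, p, b\<rangle>\<^bsub>A\<^esub>), smult = (\<lambda>\<alpha> a. act A \<alpha> p a)\<rparr>"

definition tangent_bracket :: "('k, 'a, 'm) affgebra_scheme \<Rightarrow> 'a \<Rightarrow> 'a \<Rightarrow> 'a \<Rightarrow> 'a"
  where "tangent_bracket A p a b =
    \<lbrace>a, b\<rbrace>\<^bsub>A\<^esub> \<ominus>\<^bsub>tangent_space A p\<^esub> \<lbrace>a, p\<rbrace>\<^bsub>A\<^esub> \<oplus>\<^bsub>tangent_space A p\<^esub> \<lbrace>p, p\<rbrace>\<^bsub>A\<^esub>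
      \<ominus>\<^bsub>tangent_space A p\<^esub> \<lbrace>p, b\<rbrace>\<^bsub>A\<^esub>"

definition tangent_lie_algebra :: "('k, 'a, 'm) affgebra_scheme \<Rightarrow> 'a \<Rightarrow> ('k, 'a) module"
  where "tangent_lie_algebra A p = tangent_space A p \<lparr>mult := tangent_bracket A p\<rparr>"

section \<open>Characteristic\<close>

definition ring_characteristic :: "('k, 'r) ring_scheme \<Rightarrow> nat"
  where "ring_characteristic R =
    (if \<exists>m::nat. m > 0 \<and> [m] \<cdot>\<^bsub>R\<^esub> \<one>\<^bsub>R\<^esub> = \<zero>\<^bsub>R\<^esub> then LEAST m::nat. m > 0 \<and> [m] \<cdot>\<^bsub>R\<^esub> \<one>\<^bsub>R\<^esub> = \<zero>\<^bsub>R\<^esub> else 0)"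

end

(* A Lie affgebra that is affinely nilpotent has an absorbing point e, since the terms of the
   series are non-empty. Because {e, -} = {-, e} = e, the bracket is bilinear on the vector space
   with origin e, and affine antisymmetry and the affine Jacobi identity reduce to the usual ones.
   The translation x \<mapsto> x - p + e identifies the tangent Lie algebra at p with this Lie algebra,
   and carries the m-th term of its central series into the m-th term of the affine series,
   because affine subspaces containing e are exactly linear subspaces. *)

theory Submission
  imports Defs
begin

section \<open>Heaps and tangent spaces\<close>

context heap
begin

lemma tern_cancel_right:
  assumes "x \<in> carrier H" "y \<in> carrier H" "z \<in> carrier H"
  shows "\<langle>\<langle>x, y, z\<rangle>, z, y\<rangle> = x"
  using assms by (simp flip: tern_assoc add: tern_left tern_right)

text \<open>In group terms this is \<open>a (b c^-1 d)^-1 f = a d^-1 c b^-1 f\<close>, hence the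
  reversed order of \<open>b\<close>, \<open>c\<close>, \<open>d\<close>; commutativity does not
  enter. The proof writes \<open>a\<close> as a bracket ending in \<langle>b, c, d\<rangle>, which
  then cancels against the middle entry.\<close>

lemma tern_para_assoc:
  assumes "a \<in> carrier H" "b \<in> carrier H" "c \<in> carrier H" "d \<in> carrier H" "f \<in> carrier H"
  shows "\<langle>a, \<langle>b, c, d\<rangle>, f\<rangle> = \<langle>\<langle>a, d, c\<rangle>, b, f\<rangle>"
proof -
  have "\<langle>\<langle>a, d, c\<rangle>, b, \<langle>b, c, d\<rangle>\<rangle> = a"
    using assms by (simp add: tern_assoc tern_closed tern_right tern_cancel_right)
  then have "\<langle>a, \<langle>b, c, d\<rangle>, f\<rangle> = \<langle>\<langle>\<langle>a, d, c\<rangle>, b, \<langle>b, c, d\<rangle>\<rangle>, \<langle>b, c, d\<rangle>, f\<rangle>"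
    by simp
  also have "\<dots> = \<langle>\<langle>a, d, c\<rangle>, b, f\<rangle>"
    using assms by (simp flip: tern_assoc add: tern_closed tern_left)
  finally show ?thesis .
qed

text \<open>Opening the middle bracket by \<open>tern_para_assoc\<close> brings its \<open>e\<close>
  next to the \<open>e\<close> of the first bracket, where the two cancel. This is the step that
  simplifies the expansion of a bracket of two translated points.\<close>

lemma tern_diff_diff:
  assumes "a \<in> carrier H" "b \<in> carrier H" "c \<in> carrier H" "d \<in> carrier H" "e \<in> carrier H"
  shows "\<langle>\<langle>a, b, e\<rangle>, \<langle>c, d, e\<rangle>, e\<rangle> = \<langle>\<langle>a, b, d\<rangle>, c, e\<rangle>"
proof -
  have "\<langle>\<langle>a, b, e\<rangle>, e, d\<rangle> = \<langle>a, b, d\<rangle>"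
    using assms by (simp add: tern_left flip: tern_assoc)
  then show ?thesis
    using assms by (simp add: tern_para_assoc tern_closed)
qed

end

section \<open>The vector space at a point of an affine space\<close>

context affine_space
begin

lemma act_closed:
  assumes "\<alpha> \<in> carrier K" "x \<in> carrier A" "y \<in> carrier A"
  shows "act A \<alpha> x y \<in> carrier A"
  using act_hom_point[of \<alpha> x] assms by (auto simp: heap_hom_def)

lemma act_tern:
  assumes "\<alpha> \<in> carrier K" "w \<in> carrier A" "x \<in> carrier A" "y \<in> carrier A" "z \<in> carrier A"
  shows "act A \<alpha> w \<langle>x, y, z\<rangle>\<^bsub>A\<^esub> = \<langle>act A \<alpha> w x, act A \<alpha> w y, act A \<alpha> w z\<rangle>\<^bsub>A\<^esub>"
  using act_hom_point[of \<alpha> w] assms by (auto simp: heap_hom_def)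

lemma act_self:
  assumes "\<alpha> \<in> carrier K" "x \<in> carrier A"
  shows "act A \<alpha> x x = x"
  \<comment> \<open>Base change from \<open>x\<close> to itself has two equal leading entries, which
    cancel and leave \<open>x\<close>.\<close>
  by (subst act_base_change[of \<alpha> x x x]) (use assms in \<open>simp_all add: act_closed tern_left\<close>)

lemma act_add:
  assumes "\<alpha> \<in> carrier K" "\<beta> \<in> carrier K" "x \<in> carrier A" "y \<in> carrier A"
  shows "act A (\<alpha> \<oplus>\<^bsub>K\<^esub> \<beta>) x y = \<langle>act A \<alpha> x y, x, act A \<beta> x y\<rangle>\<^bsub>A\<^esub>"
proof -
  \<comment> \<open>The heap on \<open>K\<close> offers only \<alpha> - \<beta> + \<gamma>, so the
    sum is written with zero in the middle; \<open>act_zero\<close> turns that middle term into the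
    base point \<open>x\<close>.\<close>
  have "act A (\<alpha> \<ominus>\<^bsub>K\<^esub> \<zero>\<^bsub>K\<^esub> \<oplus>\<^bsub>K\<^esub> \<beta>) x y
      = \<langle>act A \<alpha> x y, act A \<zero>\<^bsub>K\<^esub> x y, act A \<beta> x y\<rangle>\<^bsub>A\<^esub>"
    using act_hom_scalar[of x y] assms by (auto simp: heap_hom_def heap_of_ring_def)
  then show ?thesis
    using assms by (simp add: act_zero a_minus_def)
qed

lemma affine_subspace_carrier: "affine_subspace K A (carrier A)"
  using nonempty by (auto simp: affine_subspace_def tern_closed act_closed)

lemma tangent_space_abelian_group:
  assumes "p \<in> carrier A"
  shows "abelian_group (tangent_space A p)"
proof (rule abelian_groupI)
  fix x y assume "x \<in> carrier (tangent_space A p)" "y \<in> carrier (tangent_space A p)"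
  then show "x \<oplus>\<^bsub>tangent_space A p\<^esub> y = y \<oplus>\<^bsub>tangent_space A p\<^esub> x"
    using assms by (simp add: tangent_space_def tern_commute)
next
  fix x assume "x \<in> carrier (tangent_space A p)"
  \<comment> \<open>The negative of \<open>x\<close> is its reflection \<open>p - x + p\<close> in
    the origin \<open>p\<close>.\<close>
  then show "\<exists>y\<in>carrier (tangent_space A p). y \<oplus>\<^bsub>tangent_space A p\<^esub> x = \<zero>\<^bsub>tangent_space A p\<^esub>"
    using assms
    by (intro bexI[of _ "\<langle>p, x, p\<rangle>\<^bsub>A\<^esub>"])
      (simp_all add: tangent_space_def tern_closed tern_cancel_right)
qed (use assms in \<open>simp_all add: tangent_space_def tern_closed tern_assoc tern_left\<close>)

lemma tangent_space_a_inv: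
  assumes "p \<in> carrier A" "x \<in> carrier A"
  shows "\<ominus>\<^bsub>tangent_space A p\<^esub> x = \<langle>p, x, p\<rangle>\<^bsub>A\<^esub>"
proof -
  interpret T: abelian_group "tangent_space A p"
    by (rule tangent_space_abelian_group[OF assms(1)])
  show ?thesis
    by (rule T.minus_equality)
      (use assms in \<open>simp_all add: tangent_space_def tern_closed tern_cancel_right\<close>)
qed

lemma tangent_space_minus:
  assumes "p \<in> carrier A" "x \<in> carrier A" "y \<in> carrier A"
  shows "x \<ominus>\<^bsub>tangent_space A p\<^esub> y = \<langle>x, y, p\<rangle>\<^bsub>A\<^esub>"
proof -
  have "x \<ominus>\<^bsub>tangent_space A p\<^esub> y = \<langle>x, p, \<langle>p, y, p\<rangle>\<^bsub>A\<^esub>\<rangle>\<^bsub>A\<^esub>"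
    using assms by (simp add: a_minus_def tangent_space_a_inv) (simp add: tangent_space_def)
  also have "\<dots> = \<langle>x, y, p\<rangle>\<^bsub>A\<^esub>"
    using assms by (simp add: tern_assoc tern_right)
  finally show ?thesis .
qed

lemma tangent_space_module:
  assumes "p \<in> carrier A"
  shows "module K (tangent_space A p)"
  by (rule moduleI[OF K.is_cring tangent_space_abelian_group[OF assms]])
    (use assms in \<open>simp_all add: tangent_space_def act_closed act_add act_tern act_self act_mult
      act_one\<close>)

section \<open>Translation from one base point to another\<close>

lemma tern_translate:
  assumes "p \<in> carrier A" "e \<in> carrier A" "x \<in> carrier A" "y \<in> carrier A"
  shows "\<langle>\<langle>x, p, y\<rangle>\<^bsub>A\<^esub>, p, e\<rangle>\<^bsub>A\<^esub> = \<langle>\<langle>x, p, e\<rangle>\<^bsub>A\<^esub>, e, \<langle>y, p, e\<rangle>\<^bsub>A\<^esub>\<rangle>\<^bsub>A\<^esub>"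
  using assms by (simp add: tern_closed tern_left flip: tern_assoc)

text \<open>Together with \<open>tern_translate\<close> this makes the translation linear from the
  tangent space at \<open>p\<close> to that at \<open>e\<close>. Base change moves the action from
  \<open>p\<close> to \<open>e\<close>; its correction term \<open>p\<close> cancels against the
  translation, and the remainder folds up because the action at \<open>e\<close> is a heap morphism
  fixing \<open>e\<close>.\<close>

lemma act_translate:
  assumes "\<alpha> \<in> carrier K" "p \<in> carrier A" "e \<in> carrier A" "x \<in> carrier A"
  shows "\<langle>act A \<alpha> p x, p, e\<rangle>\<^bsub>A\<^esub> = act A \<alpha> e \<langle>x, p, e\<rangle>\<^bsub>A\<^esub>"
proof -
  have "\<langle>act A \<alpha> p x, p, e\<rangle>\<^bsub>A\<^esub> = \<langle>\<langle>act A \<alpha> e x, act A \<alpha> e p, p\<rangle>\<^bsub>A\<^esub>, p, e\<rangle>\<^bsub>A\<^esub>"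
    using act_base_change[of \<alpha> p x e] assms by simp
  also have "\<dots> = \<langle>act A \<alpha> e x, act A \<alpha> e p, e\<rangle>\<^bsub>A\<^esub>"
    using assms by (simp add: act_closed tern_left flip: tern_assoc)
  finally show ?thesis
    using assms by (simp add: act_tern act_self)
qed

lemma translate_inj_on:
  assumes "p \<in> carrier A" "e \<in> carrier A"
  shows "inj_on (\<lambda>x. \<langle>x, p, e\<rangle>\<^bsub>A\<^esub>) (carrier A)"
  by (rule inj_on_inverseI[of _ "\<lambda>x. \<langle>x, e, p\<rangle>\<^bsub>A\<^esub>"]) (use assms in \<open>simp add: tern_cancel_right\<close>)

lemma translate_vimage_submodule:
  assumes "affine_subspace K A W" "e \<in> W" "p \<in> carrier A"
  shows "submodule {x \<in> carrier A. \<langle>x, p, e\<rangle>\<^bsub>A\<^esub> \<in> W} K (tangent_space A p)"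
proof -
  let ?T = "tangent_space A p" and ?V = "{x \<in> carrier A. \<langle>x, p, e\<rangle>\<^bsub>A\<^esub> \<in> W}"
  interpret T: module K ?T
    by (rule tangent_space_module[OF assms(3)])
  have W: "W \<subseteq> carrier A"
    and W_tern: "\<And>x y z. \<lbrakk>x \<in> W; y \<in> W; z \<in> W\<rbrakk> \<Longrightarrow> \<langle>x, y, z\<rangle>\<^bsub>A\<^esub> \<in> W"
    and W_act: "\<And>\<alpha> x y. \<lbrakk>\<alpha> \<in> carrier K; x \<in> W; y \<in> W\<rbrakk> \<Longrightarrow> act A \<alpha> x y \<in> W"
    using assms(1) by (auto simp: affine_subspace_def)
  have e: "e \<in> carrier A"
    using W assms(2) by auto
  \<comment> \<open>The membership \<open>e \<in> W\<close> enters here: \<open>e\<close> is the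
    base point of the action inside \<open>W\<close>. Closure under negation is the case of the
    scalar -1.\<close>
  have smult: "\<alpha> \<odot>\<^bsub>?T\<^esub> x \<in> ?V" if "\<alpha> \<in> carrier K" "x \<in> ?V" for \<alpha> x
    using that assms e by (simp add: tangent_space_def act_closed act_translate W_act)
  show ?thesis
  proof (rule T.submoduleI)
    show "?V \<subseteq> carrier ?T"
      by (auto simp: tangent_space_def)
    show "\<zero>\<^bsub>?T\<^esub> \<in> ?V"
      using assms e by (simp add: tangent_space_def tern_left)
    show "x \<oplus>\<^bsub>?T\<^esub> y \<in> ?V" if "x \<in> ?V" "y \<in> ?V" for x y
      using that assms e by (simp add: tangent_space_def tern_closed tern_translate W_tern)
    show "\<ominus>\<^bsub>?T\<^esub> x \<in> ?V" if "x \<in> ?V" for x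
    proof -
      have "x \<in> carrier ?T"
        using that by (simp add: tangent_space_def)
      then have "\<ominus>\<^bsub>?T\<^esub> x = (\<ominus>\<^bsub>K\<^esub> \<one>\<^bsub>K\<^esub>) \<odot>\<^bsub>?T\<^esub> x"
        by (simp add: T.smult_l_minus)
      then show ?thesis
        using smult[of "\<ominus>\<^bsub>K\<^esub> \<one>\<^bsub>K\<^esub>" x] that by simp
    qed
  qed (rule smult)
qed

end

section \<open>The tangent Lie algebra\<close>

lemma tangent_lie_algebra_simps:
  "carrier (tangent_lie_algebra A p) = carrier A"
  "\<zero>\<^bsub>tangent_lie_algebra A p\<^esub> = p"
  "x \<oplus>\<^bsub>tangent_lie_algebra A p\<^esub> y = \<langle>x, p, y\<rangle>\<^bsub>A\<^esub>"
  "\<alpha> \<odot>\<^bsub>tangent_lie_algebra A p\<^esub> x = act A \<alpha> p x"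
  "x \<otimes>\<^bsub>tangent_lie_algebra A p\<^esub> y = tangent_bracket A p x y"
  by (simp_all add: tangent_lie_algebra_def tangent_space_def)

text \<open>Submodules are determined by addition and scalar multiplication, so results about
  \<open>tangent_space\<close> carry over to \<open>tangent_lie_algebra\<close>, which differs from
  it in \<open>mult\<close> alone.\<close>

lemma submodule_mult_update:
  "submodule W K (M\<lparr>mult := b\<rparr>) \<longleftrightarrow> submodule W K M"
  by (simp add: submodule_def submodule_axioms_def subgroup_def m_inv_def)

lemma module_mult_update:
  assumes "module K M"
  shows "module K (M\<lparr>mult := b\<rparr>)"
  using assms
  by (simp add: module_def module_axioms_def abelian_group_def abelian_monoid_def
      abelian_group_axioms_def)

section \<open>The tangent bracket and its transport to an absorbing point\<close>

context lie_affgebra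
begin

lemma affbr_closed:
  assumes "a \<in> carrier A" "b \<in> carrier A"
  shows "\<lbrace>a, b\<rbrace>\<^bsub>A\<^esub> \<in> carrier A"
  using affbr_affine_right[of a] assms by (auto simp: affine_maps_def heap_hom_def)

lemma affbr_tern_right:
  assumes "a \<in> carrier A" "x \<in> carrier A" "y \<in> carrier A" "z \<in> carrier A"
  shows "\<lbrace>a, \<langle>x, y, z\<rangle>\<^bsub>A\<^esub>\<rbrace>\<^bsub>A\<^esub> = \<langle>\<lbrace>a, x\<rbrace>\<^bsub>A\<^esub>, \<lbrace>a, y\<rbrace>\<^bsub>A\<^esub>, \<lbrace>a, z\<rbrace>\<^bsub>A\<^esub>\<rangle>\<^bsub>A\<^esub>"
  using affbr_affine_right[of a] assms by (auto simp: affine_maps_def heap_hom_def)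

lemma affbr_tern_left:
  assumes "a \<in> carrier A" "x \<in> carrier A" "y \<in> carrier A" "z \<in> carrier A"
  shows "\<lbrace>\<langle>x, y, z\<rangle>\<^bsub>A\<^esub>, a\<rbrace>\<^bsub>A\<^esub> = \<langle>\<lbrace>x, a\<rbrace>\<^bsub>A\<^esub>, \<lbrace>y, a\<rbrace>\<^bsub>A\<^esub>, \<lbrace>z, a\<rbrace>\<^bsub>A\<^esub>\<rangle>\<^bsub>A\<^esub>"
  using affbr_affine_left[of a] assms by (auto simp: affine_maps_def heap_hom_def)

lemma affbr_act_right:
  assumes "a \<in> carrier A" "\<alpha> \<in> carrier K" "x \<in> carrier A" "y \<in> carrier A"
  shows "\<lbrace>a, act A \<alpha> x y\<rbrace>\<^bsub>A\<^esub> = act A \<alpha> \<lbrace>a, x\<rbrace>\<^bsub>A\<^esub> \<lbrace>a, y\<rbrace>\<^bsub>A\<^esub>"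
  using affbr_affine_right[of a] assms by (auto simp: affine_maps_def)

lemma affbr_act_left:
  assumes "a \<in> carrier A" "\<alpha> \<in> carrier K" "x \<in> carrier A" "y \<in> carrier A"
  shows "\<lbrace>act A \<alpha> x y, a\<rbrace>\<^bsub>A\<^esub> = act A \<alpha> \<lbrace>x, a\<rbrace>\<^bsub>A\<^esub> \<lbrace>y, a\<rbrace>\<^bsub>A\<^esub>"
  using affbr_affine_left[of a] assms by (auto simp: affine_maps_def)

text \<open>A subtraction in the tangent space ends in \<open>p\<close> and the following addition
  starts from \<open>p\<close>, so these two occurrences cancel; only the \<open>p\<close> of the
  last subtraction remains.\<close>

lemma tangent_bracket_eq:
  assumes "p \<in> carrier A" "x \<in> carrier A" "y \<in> carrier A"
  shows "tangent_bracket A p x y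
    = \<langle>\<langle>\<lbrace>x, y\<rbrace>\<^bsub>A\<^esub>, \<lbrace>x, p\<rbrace>\<^bsub>A\<^esub>, \<lbrace>p, p\<rbrace>\<^bsub>A\<^esub>\<rangle>\<^bsub>A\<^esub>, \<lbrace>p, y\<rbrace>\<^bsub>A\<^esub>, p\<rangle>\<^bsub>A\<^esub>"
proof -
  have add: "u \<oplus>\<^bsub>tangent_space A p\<^esub> v = \<langle>u, p, v\<rangle>\<^bsub>A\<^esub>" for u v
    by (simp add: tangent_space_def)
  have "\<langle>\<langle>\<lbrace>x, y\<rbrace>\<^bsub>A\<^esub>, \<lbrace>x, p\<rbrace>\<^bsub>A\<^esub>, p\<rangle>\<^bsub>A\<^esub>, p, \<lbrace>p, p\<rbrace>\<^bsub>A\<^esub>\<rangle>\<^bsub>A\<^esub>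
      = \<langle>\<lbrace>x, y\<rbrace>\<^bsub>A\<^esub>, \<lbrace>x, p\<rbrace>\<^bsub>A\<^esub>, \<lbrace>p, p\<rbrace>\<^bsub>A\<^esub>\<rangle>\<^bsub>A\<^esub>"
    using assms by (simp add: affbr_closed tern_left flip: tern_assoc)
  then show ?thesis
    using assms
    by (simp add: tangent_bracket_def tangent_space_minus affbr_closed add tern_closed)
qed

lemma tangent_bracket_closed:
  assumes "p \<in> carrier A" "x \<in> carrier A" "y \<in> carrier A"
  shows "tangent_bracket A p x y \<in> carrier A"
  using assms by (simp add: tangent_bracket_eq affbr_closed tern_closed)

lemma absorbing_points_eq_singleton:
  assumes "e \<in> absorbing_points A"
  shows "absorbing_points A = {e}"
proof -
  have "x = e" if "x \<in> absorbing_points A" for x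
  proof -
    have "\<lbrace>x, e\<rbrace>\<^bsub>A\<^esub> = x" "\<lbrace>x, e\<rbrace>\<^bsub>A\<^esub> = e"
      using that assms by (auto simp: absorbing_points_def)
    then show ?thesis
      by simp
  qed
  with assms show ?thesis
    by blast
qed

text \<open>Expanding the right-hand side affinely in both arguments, every bracket with an entry
  \<open>e\<close> collapses to \<open>e\<close>. What is left is the alternating sum of the
  brackets of \<open>x\<close>, \<open>y\<close> and \<open>p\<close> based at \<open>e\<close>,
  that is, the formula of \<open>tangent_bracket_eq\<close> with its final \<open>p\<close> moved to
  \<open>e\<close>.\<close>

lemma translate_tangent_bracket:
  assumes "e \<in> absorbing_points A" "p \<in> carrier A" "x \<in> carrier A" "y \<in> carrier A"
  shows "\<langle>tangent_bracket A p x y, p, e\<rangle>\<^bsub>A\<^esub> = \<lbrace>\<langle>x, p, e\<rangle>\<^bsub>A\<^esub>, \<langle>y, p, e\<rangle>\<^bsub>A\<^esub>\<rbrace>\<^bsub>A\<^esub>"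
proof -
  have e: "e \<in> carrier A" and e_left: "\<And>a. a \<in> carrier A \<Longrightarrow> \<lbrace>e, a\<rbrace>\<^bsub>A\<^esub> = e"
    and e_right: "\<And>a. a \<in> carrier A \<Longrightarrow> \<lbrace>a, e\<rbrace>\<^bsub>A\<^esub> = e"
    using assms(1) by (auto simp: absorbing_points_def)
  let ?xy = "\<lbrace>x, y\<rbrace>\<^bsub>A\<^esub>" and ?xp = "\<lbrace>x, p\<rbrace>\<^bsub>A\<^esub>" and ?py = "\<lbrace>p, y\<rbrace>\<^bsub>A\<^esub>" and ?pp = "\<lbrace>p, p\<rbrace>\<^bsub>A\<^esub>"
  let ?y = "\<langle>y, p, e\<rangle>\<^bsub>A\<^esub>"
  have "\<lbrace>\<langle>x, p, e\<rangle>\<^bsub>A\<^esub>, ?y\<rbrace>\<^bsub>A\<^esub> = \<langle>\<lbrace>x, ?y\<rbrace>\<^bsub>A\<^esub>, \<lbrace>p, ?y\<rbrace>\<^bsub>A\<^esub>, e\<rangle>\<^bsub>A\<^esub>"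
    using assms e by (simp add: affbr_tern_left tern_closed e_left)
  also have "\<dots> = \<langle>\<langle>?xy, ?xp, e\<rangle>\<^bsub>A\<^esub>, \<langle>?py, ?pp, e\<rangle>\<^bsub>A\<^esub>, e\<rangle>\<^bsub>A\<^esub>"
    using assms e by (simp add: affbr_tern_right e_right)
  also have "\<dots> = \<langle>\<langle>?xy, ?xp, ?pp\<rangle>\<^bsub>A\<^esub>, ?py, e\<rangle>\<^bsub>A\<^esub>"
    using assms e by (intro tern_diff_diff) (simp_all add: affbr_closed)
  also have "\<dots> = \<langle>tangent_bracket A p x y, p, e\<rangle>\<^bsub>A\<^esub>"
    using assms e
    by (simp add: tangent_bracket_eq affbr_closed tern_closed tern_left flip: tern_assoc)
  finally show ?thesis ..
qed

text \<open>The identities for the bracket are checked after applying the injective map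
  \<open>?\<sigma>\<close>, which turns each of them into an identity of the affine bracket with
  origin \<open>e\<close>.\<close>

lemma tangent_lie_algebra_lie_algebra:
  assumes E: "e \<in> absorbing_points A" and p: "p \<in> carrier A"
  shows "lie_algebra K (tangent_lie_algebra A p)"
proof -
  let ?\<sigma> = "\<lambda>x. \<langle>x, p, e\<rangle>\<^bsub>A\<^esub>"
  have e: "e \<in> carrier A" and e_left: "\<And>a. a \<in> carrier A \<Longrightarrow> \<lbrace>e, a\<rbrace>\<^bsub>A\<^esub> = e"
    and e_right: "\<And>a. a \<in> carrier A \<Longrightarrow> \<lbrace>a, e\<rbrace>\<^bsub>A\<^esub> = e"
    using E by (auto simp: absorbing_points_def)
  \<comment> \<open>In antisymmetry for the pair \<open>e\<close>, \<open>a\<close>, every bracket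
    other than \<lbrace>a, a\<rbrace> equals \<open>e\<close>.\<close>
  have alt: "\<lbrace>a, a\<rbrace>\<^bsub>A\<^esub> = e" if "a \<in> carrier A" for a
    using affine_antisymmetry[OF e that] that e
    by (simp add: e_left e_right tern_left)
  \<comment> \<open>By \<open>alt\<close> and absorption the terms \<lbrace>a, \<lbrace>a,
    a\<rbrace>\<rbrace> are all \<open>e\<close>, so the five-fold bracket becomes a sum of three
    terms with origin \<open>e\<close>.\<close>
  have Jacobi: "\<langle>\<langle>\<lbrace>a, \<lbrace>b, c\<rbrace>\<^bsub>A\<^esub>\<rbrace>\<^bsub>A\<^esub>, e, \<lbrace>b, \<lbrace>c, a\<rbrace>\<^bsub>A\<^esub>\<rbrace>\<^bsub>A\<^esub>\<rangle>\<^bsub>A\<^esub>, e, \<lbrace>c, \<lbrace>a, b\<rbrace>\<^bsub>A\<^esub>\<rbrace>\<^bsub>A\<^esub>\<rangle>\<^bsub>A\<^esub> = e"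
    if "a \<in> carrier A" "b \<in> carrier A" "c \<in> carrier A" for a b c
    using affine_Jacobi[OF that] that by (simp add: alt e_right)
  have \<sigma>I: "x = y" if "?\<sigma> x = ?\<sigma> y" "x \<in> carrier A" "y \<in> carrier A" for x y
    using inj_onD[OF translate_inj_on[OF p e]] that by simp
  note \<sigma>_simps = translate_tangent_bracket[OF E p] tern_translate[OF p e] act_translate[OF _ p e]
  note closed = tern_closed affbr_closed act_closed tangent_bracket_closed p e
  \<comment> \<open>An affine map fixing the origin is linear: absorption says that bracketing with
    \<open>c\<close> on either side sends \<open>e\<close> to \<open>e\<close>.\<close>
  have add:
    "\<lbrace>\<langle>a, e, b\<rangle>\<^bsub>A\<^esub>, c\<rbrace>\<^bsub>A\<^esub> = \<langle>\<lbrace>a, c\<rbrace>\<^bsub>A\<^esub>, e, \<lbrace>b, c\<rbrace>\<^bsub>A\<^esub>\<rangle>\<^bsub>A\<^esub>"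
    "\<lbrace>c, \<langle>a, e, b\<rangle>\<^bsub>A\<^esub>\<rbrace>\<^bsub>A\<^esub> = \<langle>\<lbrace>c, a\<rbrace>\<^bsub>A\<^esub>, e, \<lbrace>c, b\<rbrace>\<^bsub>A\<^esub>\<rangle>\<^bsub>A\<^esub>"
    if "a \<in> carrier A" "b \<in> carrier A" "c \<in> carrier A" for a b c
    using that e e_left e_right by (simp_all add: affbr_tern_left affbr_tern_right)
  have smult:
    "\<lbrace>act A \<alpha> e a, c\<rbrace>\<^bsub>A\<^esub> = act A \<alpha> e \<lbrace>a, c\<rbrace>\<^bsub>A\<^esub>"
    "\<lbrace>c, act A \<alpha> e a\<rbrace>\<^bsub>A\<^esub> = act A \<alpha> e \<lbrace>c, a\<rbrace>\<^bsub>A\<^esub>"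
    if "\<alpha> \<in> carrier K" "a \<in> carrier A" "c \<in> carrier A" for \<alpha> a c
    using that e e_left e_right by (simp_all add: affbr_act_left affbr_act_right)
  note bilinear = add smult
  show ?thesis
  proof (rule lie_algebra.intro)
    show "field K"
      by (rule K.field_axioms)
    show "module K (tangent_lie_algebra A p)"
      unfolding tangent_lie_algebra_def
      by (rule module_mult_update[OF tangent_space_module[OF p]])
    show "lie_algebra_axioms K (tangent_lie_algebra A p)"
    proof (unfold_locales, unfold tangent_lie_algebra_simps)
      fix x y z
      assume x: "x \<in> carrier A" and y: "y \<in> carrier A" and z: "z \<in> carrier A"
      show "tangent_bracket A p (\<langle>x, p, y\<rangle>\<^bsub>A\<^esub>) z
          = \<langle>tangent_bracket A p x z, p, tangent_bracket A p y z\<rangle>\<^bsub>A\<^esub>"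
        by (rule \<sigma>I) (simp_all add: x y z \<sigma>_simps closed bilinear)
      show "tangent_bracket A p x (\<langle>y, p, z\<rangle>\<^bsub>A\<^esub>)
          = \<langle>tangent_bracket A p x y, p, tangent_bracket A p x z\<rangle>\<^bsub>A\<^esub>"
        by (rule \<sigma>I) (simp_all add: x y z \<sigma>_simps closed bilinear)
      \<comment> \<open>The zero \<open>p\<close> on the right is sent by \<open>?\<sigma>\<close>
        to \<open>e\<close>, the value in the Jacobi identity above.\<close>
      show "\<langle>\<langle>tangent_bracket A p x (tangent_bracket A p y z), p,
          tangent_bracket A p y (tangent_bracket A p z x)\<rangle>\<^bsub>A\<^esub>, p,
          tangent_bracket A p z (tangent_bracket A p x y)\<rangle>\<^bsub>A\<^esub> = p"
        by (rule \<sigma>I) (simp_all add: x y z \<sigma>_simps closed Jacobi tern_left)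
    next
      fix \<alpha> x y
      assume \<alpha>: "\<alpha> \<in> carrier K" and x: "x \<in> carrier A" and y: "y \<in> carrier A"
      show "tangent_bracket A p (act A \<alpha> p x) y = act A \<alpha> p (tangent_bracket A p x y)"
        by (rule \<sigma>I) (simp_all add: \<alpha> x y \<sigma>_simps closed bilinear)
      show "tangent_bracket A p x (act A \<alpha> p y) = act A \<alpha> p (tangent_bracket A p x y)"
        by (rule \<sigma>I) (simp_all add: \<alpha> x y \<sigma>_simps closed bilinear)
    next
      fix x assume x: "x \<in> carrier A"
      show "tangent_bracket A p x x = p"
        by (rule \<sigma>I) (simp_all add: x \<sigma>_simps closed alt tern_left)
    qed (simp add: p tangent_bracket_closed)
  qed
qed

section \<open>The affine series and the central series\<close>

lemma absorbing_point_in_aff_series: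
  assumes "e \<in> absorbing_points A"
  shows "e \<in> aff_series K A m"
proof (induction m)
  case 0
  then show ?case
    using assms by (simp add: absorbing_points_def)
next
  case (Suc m)
  \<comment> \<open>Since \<open>e\<close> is its own bracket with itself and lies in the previous
    term, it lies in every subspace of the intersection.\<close>
  have "e \<in> carrier A" "\<lbrace>e, e\<rbrace>\<^bsub>A\<^esub> = e"
    using assms by (auto simp: absorbing_points_def)
  with Suc show ?case
    by (auto simp: affbr_set_def) metis
qed

text \<open>The whole space is one of the subspaces intersected. This also shows that the family has
  a member; an empty family would have intersection \<open>UNIV\<close>.\<close>

lemma aff_series_subset_carrier: "aff_series K A m \<subseteq> carrier A"
proof (induction m)
  case (Suc m)
  have "\<forall>x\<in>carrier A. \<forall>y\<in>aff_series K A m. \<lbrace>x, y\<rbrace>\<^bsub>A\<^esub> \<in> carrier A"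
    using Suc by (auto simp: affbr_closed)
  with affine_subspace_carrier show ?case
    by (auto simp: affbr_set_def)
qed simp

text \<open>An intersection of non-empty subspaces could be empty, but a bracket with an element of
  the previous term lies in all of them. No absorbing point is assumed, so that one can be obtained
  from this lemma.\<close>

lemma aff_series_nonempty: "aff_series K A m \<noteq> {}"
proof (induction m)
  case 0
  then show ?case
    by (simp add: nonempty)
next
  case (Suc m)
  then obtain x where "x \<in> aff_series K A m"
    by auto
  moreover from this have "x \<in> carrier A"
    using aff_series_subset_carrier by auto
  ultimately have "\<lbrace>x, x\<rbrace>\<^bsub>A\<^esub> \<in> aff_series K A (Suc m)"
    by (auto simp: affbr_set_def)
  then show ?case
    by blast
qed

lemma translate_lie_series:
  assumes E: "e \<in> absorbing_points A" and p: "p \<in> carrier A"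
  shows "lie_series K (tangent_lie_algebra A p) m
    \<subseteq> {x \<in> carrier A. \<langle>x, p, e\<rangle>\<^bsub>A\<^esub> \<in> aff_series K A m}"
proof (induction m)
  case 0
  have "e \<in> carrier A"
    using E by (simp add: absorbing_points_def)
  then show ?case
    using p by (auto simp: tangent_lie_algebra_simps tern_closed)
next
  case (Suc m)
  let ?L = "tangent_lie_algebra A p"
  have e: "e \<in> carrier A" and ee: "\<lbrace>e, e\<rbrace>\<^bsub>A\<^esub> = e"
    using E by (auto simp: absorbing_points_def)
  have *: "lie_series K ?L (Suc m) \<subseteq> {x \<in> carrier A. \<langle>x, p, e\<rangle>\<^bsub>A\<^esub> \<in> W}" (is "_ \<subseteq> ?V")
    if W: "affine_subspace K A W" "\<forall>x\<in>carrier A. \<forall>y\<in>aff_series K A m. \<lbrace>x, y\<rbrace>\<^bsub>A\<^esub> \<in> W" for W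
  proof -
    \<comment> \<open>\<open>W\<close> contains the brackets with elements of the
      \<open>m\<close>-th term, among them \<lbrace>e, e\<rbrace> = e.\<close>
    have "e \<in> W"
      using W(2) e ee absorbing_point_in_aff_series[OF E] by metis
    then have "submodule ?V K ?L"
      unfolding tangent_lie_algebra_def submodule_mult_update
      by (rule translate_vimage_submodule[OF W(1) _ p])
    moreover have "x \<otimes>\<^bsub>?L\<^esub> y \<in> ?V" if "x \<in> carrier ?L" "y \<in> lie_series K ?L m" for x y
    proof -
      have "x \<in> carrier A" "y \<in> carrier A" "\<langle>y, p, e\<rangle>\<^bsub>A\<^esub> \<in> aff_series K A m"
        using that Suc by (auto simp: tangent_lie_algebra_simps)
      then show ?thesis
        using W(2) p e
        by (simp add: tangent_lie_algebra_simps tangent_bracket_closed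
            translate_tangent_bracket[OF E p] tern_closed)
    qed
    ultimately show ?thesis
      unfolding lie_series.simps lie_set_def by (intro Inter_lower) simp
  qed
  \<comment> \<open>Membership in the carrier follows from \<open>*\<close> only once some
    \<open>W\<close> is exhibited; the whole space serves.\<close>
  have "lie_series K ?L (Suc m) \<subseteq> carrier A"
    using *[OF affine_subspace_carrier] aff_series_subset_carrier affbr_closed by blast
  with * show ?case
    by (auto simp: affbr_set_def simp del: lie_series.simps)
qed

end

text \<open>Every submodule contains zero. This complements \<open>translate_lie_series\<close>,
  which bounds the Lie series only from above.\<close>

lemma (in module) zero_in_lie_series: "\<zero>\<^bsub>M\<^esub> \<in> lie_series R M m"
proof (cases m)
  case (Suc m')
  have "\<zero>\<^bsub>M\<^esub> \<in> W" if "submodule W R M" for W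
    using subgroup.one_closed[OF submodule.axioms(1)[OF that]] by simp
  then show ?thesis
    by (simp add: Suc lie_set_def)
qed simp

theorem theorem6p1:
  fixes K :: "('k, 'r) ring_scheme" and A :: "('k, 'a, 'm) affgebra_scheme" and p :: 'a and n :: nat
  assumes "field K" and "ring_characteristic K \<noteq> 2"
    and "lie_affgebra K A"
    and "affinely_nilpotent K A n"
    and "p \<in> carrier A"
  shows "lie_algebra K (tangent_lie_algebra A p) \<and> lie_nilpotent K (tangent_lie_algebra A p) n"
proof -
  interpret lie_affgebra K A
    by (rule assms(3))
  let ?L = "tangent_lie_algebra A p"
  have n: "n > 0" and series: "\<And>k. aff_series K A (n + k) = absorbing_points A"
    using assms(4) by (auto simp: affinely_nilpotent_def)
  \<comment> \<open>Nilpotency identifies the non-empty \<open>n\<close>-th term with the set of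
    absorbing points.\<close>
  obtain e where E: "e \<in> absorbing_points A"
    using aff_series_nonempty[of "n + 0"] series[of 0] by auto
  then have e: "e \<in> carrier A"
    by (simp add: absorbing_points_def)
  have lie: "lie_algebra K ?L"
    by (rule tangent_lie_algebra_lie_algebra[OF E assms(5)])
  have "lie_series K ?L (n + k) = {\<zero>\<^bsub>?L\<^esub>}" for k
  proof -
    have "x = p" if "x \<in> lie_series K ?L (n + k)" for x
    proof -
      \<comment> \<open>The translate of \<open>x\<close> lies in the singleton of \<open>e\<close>,
        and \<open>e\<close> is the translate of \<open>p\<close>; injectivity then gives
        \<open>x = p\<close>.\<close>
      have "x \<in> carrier A" "\<langle>x, p, e\<rangle>\<^bsub>A\<^esub> = \<langle>p, p, e\<rangle>\<^bsub>A\<^esub>"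
        using that translate_lie_series[OF E assms(5), of "n + k"] assms(5) e
        by (auto simp: series absorbing_points_eq_singleton[OF E] tern_left)
      then show ?thesis
        using inj_onD[OF translate_inj_on[OF assms(5) e]] assms(5) by blast
    qed
    moreover have "\<zero>\<^bsub>?L\<^esub> \<in> lie_series K ?L (n + k)"
      using lie by (intro module.zero_in_lie_series) (simp add: lie_algebra_def)
    ultimately show ?thesis
      by (auto simp: tangent_lie_algebra_simps)
  qed
  \<comment> \<open>The instance \<open>k = 0\<close> is the clause of \<open>lie_nilpotent\<close>
    for the index \<open>n\<close> itself.\<close>
  from this[of 0] this have "lie_nilpotent K ?L n"
    using n by (simp add: lie_nilpotent_def)
  with lie show ?thesis ..
qed

end
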